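(* There is no graphical characterization of semiprimeness for evolution algebras, i.e., there is no isomorphism-closed class $\mathcal G$ of directed graphs such that for every field $K$, every evolution $K$-algebra $A$ and every natural basis $B$ of $A$ with associated graph $E$, the algebra $A$ is semiprime if and only if $E\in\mathcal G$. The same holds true for perfection: there is no isomorphism-closed class $\mathcal G$ of directed graphs such that for every field $K$, every evolution $K$-algebra $A$ and every natural basis $B$ of $A$ with associated graph $E$, the algebra $A$ is perfect if and only if $E\in\mathcal G$.
   Context: Algebras are not assumed associative. An evolution algebra over $K$ is a $K$-algebra $A$ having a basis $B=\{e_i\}_{i\in\Lambda}$ (a natural basis) with $e_ie_j=0$ for all $i\ne j$. Write $e_i^2=\sum_{j\in\Lambda}\omega_{ji}e_j$. The directed graph $E$ associated to $A$ relative to $B$ has vertex set $E^0=\{e_i\}_{i\in\Lambda}$ and exactly one edge from $e_i$ to $e_j$ if $\omega_{ji}\neq 0$, and none otherwise. $A$ is semiprime if any ideal $I$ of $A$ with $I^2=0$ is $0$. $A$ is perfect if $A=A^2$. *)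

theory Defs
  imports
    "Jordan_Normal_Form.Missing_VectorSpace"
    "Graph_Theory.Digraph_Isomorphism"
begin

text \<open>
  A not necessarily associative algebra over a field.  The record type
  \<^typ>\<open>('k, 'v) module\<close> already carries a multiplication; its unit
  component is ignored (as it is in the locale \<^locale>\<open>module\<close>).
\<close>

locale nonassoc_algebra = vectorspace K A
  for K :: "('k, 'm) ring_scheme" and A :: "('k, 'v, 'n) module_scheme" +
  assumes mult_closed:
      "\<lbrakk>x \<in> carrier A; y \<in> carrier A\<rbrakk> \<Longrightarrow> x \<otimes>\<^bsub>A\<^esub> y \<in> carrier A"
    and mult_distr_left:
      "\<lbrakk>x \<in> carrier A; y \<in> carrier A; z \<in> carrier A\<rbrakk>
        \<Longrightarrow> (x \<oplus>\<^bsub>A\<^esub> y) \<otimes>\<^bsub>A\<^esub> z = x \<otimes>\<^bsub>A\<^esub> z \<oplus>\<^bsub>A\<^esub> y \<otimes>\<^bsub>A\<^esub> z"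
    and mult_distr_right:
      "\<lbrakk>x \<in> carrier A; y \<in> carrier A; z \<in> carrier A\<rbrakk>
        \<Longrightarrow> x \<otimes>\<^bsub>A\<^esub> (y \<oplus>\<^bsub>A\<^esub> z) = x \<otimes>\<^bsub>A\<^esub> y \<oplus>\<^bsub>A\<^esub> x \<otimes>\<^bsub>A\<^esub> z"
    and mult_smult_left:
      "\<lbrakk>c \<in> carrier K; x \<in> carrier A; y \<in> carrier A\<rbrakk>
        \<Longrightarrow> (c \<odot>\<^bsub>A\<^esub> x) \<otimes>\<^bsub>A\<^esub> y = c \<odot>\<^bsub>A\<^esub> (x \<otimes>\<^bsub>A\<^esub> y)"
    and mult_smult_right:
      "\<lbrakk>c \<in> carrier K; x \<in> carrier A; y \<in> carrier A\<rbrakk>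
        \<Longrightarrow> x \<otimes>\<^bsub>A\<^esub> (c \<odot>\<^bsub>A\<^esub> y) = c \<odot>\<^bsub>A\<^esub> (x \<otimes>\<^bsub>A\<^esub> y)"
begin

definition set_product :: "'v set \<Rightarrow> 'v set \<Rightarrow> 'v set" where
  "set_product S T = span {x \<otimes>\<^bsub>A\<^esub> y | x y. x \<in> S \<and> y \<in> T}"

definition two_sided_ideal :: "'v set \<Rightarrow> bool" where
  "two_sided_ideal I \<longleftrightarrow> VectorSpace.subspace K I A \<and>
     (\<forall>x\<in>carrier A. \<forall>y\<in>I. x \<otimes>\<^bsub>A\<^esub> y \<in> I \<and> y \<otimes>\<^bsub>A\<^esub> x \<in> I)"

definition semiprime :: bool where
  "semiprime \<longleftrightarrow>
     (\<forall>I. two_sided_ideal I \<and> set_product I I = {\<zero>\<^bsub>A\<^esub>} \<longrightarrow> I = {\<zero>\<^bsub>A\<^esub>})"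

definition perfect :: bool where
  "perfect \<longleftrightarrow> carrier A = set_product (carrier A) (carrier A)"

definition natural_basis :: "'v set \<Rightarrow> bool" where
  "natural_basis B \<longleftrightarrow> basis B \<and>
     (\<forall>e\<in>B. \<forall>f\<in>B. e \<noteq> f \<longrightarrow> e \<otimes>\<^bsub>A\<^esub> f = \<zero>\<^bsub>A\<^esub>)"

text \<open>
  The finitely supported coordinate family of \<open>x\<close> with respect to a (possibly
  infinite) basis \<open>B\<close>.  It is taken to be extensional outside \<open>B\<close>, which
  makes it unique.
\<close>

definition coordinates :: "'v set \<Rightarrow> 'v \<Rightarrow> 'v \<Rightarrow> 'k" where
  "coordinates B x = (THE a. a \<in> B \<rightarrow>\<^sub>E carrier K \<and>
     finite {e \<in> B. a e \<noteq> \<zero>\<^bsub>K\<^esub>} \<and> lincomb a {e \<in> B. a e \<noteq> \<zero>\<^bsub>K\<^esub>} = x)"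

text \<open>\<open>structure_const B f e\<close> is the coefficient of \<open>f\<close> in \<open>e\<close> squared
  (\<open>\<omega>\<^sub>j\<^sub>i\<close> for \<open>f = e\<^sub>j\<close> and \<open>e = e\<^sub>i\<close>).\<close>

definition structure_const :: "'v set \<Rightarrow> 'v \<Rightarrow> 'v \<Rightarrow> 'k" where
  "structure_const B f e = coordinates B (e \<otimes>\<^bsub>A\<^esub> e) f"

definition associated_graph :: "'v set \<Rightarrow> ('v, 'v \<times> 'v) pre_digraph" where
  "associated_graph B =
     \<lparr>verts = B,
      arcs = {(e, f). e \<in> B \<and> f \<in> B \<and> structure_const B f e \<noteq> \<zero>\<^bsub>K\<^esub>},
      tail = fst, head = snd\<rparr>"

end

locale evolution_algebra = nonassoc_algebra +
  assumes ex_natural_basis: "\<exists>B. natural_basis B"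

text \<open>
  HOL cannot quantify over types inside a formula, so a statement about all fields,
  all algebras and a class of graphs is made relative to a universe of scalars
  \<open>'k\<close> and a universe of vectors \<open>'v\<close>: fields have carrier in \<open>'k\<close>, algebras (hence the
  vertices of their graphs) have carrier in \<open>'v\<close>.  A non-existence statement of this kind
  is inherited by larger universes, because a class of graphs on a larger universe
  restricts to one on a smaller universe.
\<close>

definition iso_closed_graph_class :: "('a, 'b) pre_digraph set \<Rightarrow> bool" where
  "iso_closed_graph_class \<G> \<longleftrightarrow>
     (\<forall>G\<in>\<G>. wf_digraph G) \<and> (\<forall>G\<in>\<G>. \<forall>H. digraph_iso G H \<longrightarrow> H \<in> \<G>)"

end

theory Submission
  imports
    Defs
    "HOL-Number_Theory.Residues"
    "HOL-Algebra.Weak_Morphisms"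
begin

text \<open>
  The graph of an evolution algebra records only which structure constants vanish, whereas
  perfection and semiprimeness depend on their values.  In dimension two, let
  \<open>e\<^sub>1\<^sup>2 = a e\<^sub>1 + b e\<^sub>2\<close> and \<open>e\<^sub>2\<^sup>2 = c e\<^sub>1 + d e\<^sub>2\<close>, with all four constants nonzero: the graph is
  then the complete digraph with loops on two vertices, whatever the constants are.

  If \<open>a d - b c \<noteq> 0\<close>, the two squares span the plane, so the algebra is perfect.  It is also
  semiprime, because no nonzero vector has square zero: \<open>(x, y)\<^sup>2 = x\<^sup>2 e\<^sub>1\<^sup>2 + y\<^sup>2 e\<^sub>2\<^sup>2\<close>, and
  \<open>e\<^sub>1\<^sup>2\<close>, \<open>e\<^sub>2\<^sup>2\<close> are independent (\<open>square_vec_eq_zero\<close>).  If instead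
  \<open>e\<^sub>1\<^sup>2 = e\<^sub>1 + e\<^sub>2 = - e\<^sub>2\<^sup>2\<close>, every product is a multiple of \<open>e\<^sub>1 + e\<^sub>2\<close>, so the algebra is not
  perfect; and \<open>(e\<^sub>1 + e\<^sub>2)\<^sup>2 = 0\<close>, so the diagonal is a nonzero ideal of square zero.

  The constants \<open>(1, 1, 1, -1)\<close> and \<open>(1, 1, -1, -1)\<close> realise the two cases as soon as the
  determinant \<open>-2\<close> of the first is nonzero.  The field with three elements satisfies this and,
  like the plane over it, is finite; hence a copy of each fits into any infinite type.
  Using the same vectors for both algebras makes their graphs equal, so that
  no class of graphs can contain one of them and omit the other.
\<close>

section \<open>Products of subsets\<close>

context nonassoc_algebra
begin

lemma products_in_carrier:
  assumes "S \<subseteq> carrier A" "T \<subseteq> carrier A"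
  shows "{x \<otimes>\<^bsub>A\<^esub> y | x y. x \<in> S \<and> y \<in> T} \<subseteq> carrier A"
  using assms mult_closed by blast

lemma submodule_set_product:
  assumes "S \<subseteq> carrier A" "T \<subseteq> carrier A"
  shows "LinearCombinations.submodule K (set_product S T) A"
  unfolding set_product_def by (rule span_is_submodule[OF products_in_carrier[OF assms]])

lemma product_in_set_product:
  assumes "S \<subseteq> carrier A" "T \<subseteq> carrier A" "x \<in> S" "y \<in> T"
  shows "x \<otimes>\<^bsub>A\<^esub> y \<in> set_product S T"
  unfolding set_product_def
  using in_own_span[OF products_in_carrier[OF assms(1,2)]] assms(3,4) by blast

end

section \<open>Evolution algebras of dimension two\<close>

text \<open>
  The injection \<open>vec\<close> carries the plane over \<open>K\<close> into a prescribed type of vectors.  Asking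
  for injectivity only on pairs from the carrier lets a finite field do with any infinite type
  of vectors, even one smaller than the type of scalars.
\<close>

locale evolution_plane = field K
  for K :: "('k, 'm) ring_scheme" (structure) +
  fixes vec :: "'k \<Rightarrow> 'k \<Rightarrow> 'v" and a b c d :: 'k
  assumes inj_vec: "inj_on (case_prod vec) (carrier K \<times> carrier K)"
    and const_closed [simp, intro]:
      "a \<in> carrier K" "b \<in> carrier K" "c \<in> carrier K" "d \<in> carrier K"
begin

definition coords :: "'v \<Rightarrow> 'k \<times> 'k" where
  "coords = inv_into (carrier K \<times> carrier K) (case_prod vec)"

text \<open>
  The \<open>one\<close> component is a dummy value, as an evolution algebra need not have a unit.
\<close>

definition plane :: "('k, 'v) module" where
  "plane =
    \<lparr>carrier = case_prod vec ` (carrier K \<times> carrier K),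
     monoid.mult = (\<lambda>v w. case (coords v, coords w) of ((x, y), (x', y')) \<Rightarrow>
       vec (a \<otimes> (x \<otimes> x') \<oplus> c \<otimes> (y \<otimes> y')) (b \<otimes> (x \<otimes> x') \<oplus> d \<otimes> (y \<otimes> y'))),
     one = vec \<zero> \<zero>,
     zero = vec \<zero> \<zero>,
     add = (\<lambda>v w. case (coords v, coords w) of ((x, y), (x', y')) \<Rightarrow> vec (x \<oplus> x') (y \<oplus> y')),
     smult = (\<lambda>r v. case coords v of (x, y) \<Rightarrow> vec (r \<otimes> x) (r \<otimes> y))\<rparr>"

definition unit_vectors :: "'v set" where
  "unit_vectors = {vec \<one> \<zero>, vec \<zero> \<one>}"

lemma vec_eq_iff [simp]:
  "\<lbrakk>x \<in> carrier K; y \<in> carrier K; x' \<in> carrier K; y' \<in> carrier K\<rbrakk>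
    \<Longrightarrow> vec x y = vec x' y' \<longleftrightarrow> x = x' \<and> y = y'"
  using inj_onD[OF inj_vec, of "(x, y)" "(x', y')"] by auto

lemma coords_vec [simp]:
  "\<lbrakk>x \<in> carrier K; y \<in> carrier K\<rbrakk> \<Longrightarrow> coords (vec x y) = (x, y)"
  using inv_into_f_f[OF inj_vec, of "(x, y)"] by (simp add: coords_def)

lemma vec_in_plane [simp, intro]:
  "\<lbrakk>x \<in> carrier K; y \<in> carrier K\<rbrakk> \<Longrightarrow> vec x y \<in> carrier plane"
  by (auto simp: plane_def)

lemma plane_cases:
  assumes "v \<in> carrier plane"
  obtains x y where "x \<in> carrier K" "y \<in> carrier K" "v = vec x y"
  using assms by (auto simp: plane_def)

lemma zero_plane: "\<zero>\<^bsub>plane\<^esub> = vec \<zero> \<zero>"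
  by (simp add: plane_def)

lemma add_vec [simp]:
  "\<lbrakk>x \<in> carrier K; y \<in> carrier K; x' \<in> carrier K; y' \<in> carrier K\<rbrakk>
    \<Longrightarrow> vec x y \<oplus>\<^bsub>plane\<^esub> vec x' y' = vec (x \<oplus> x') (y \<oplus> y')"
  by (simp add: plane_def)

lemma smult_vec [simp]:
  "\<lbrakk>r \<in> carrier K; x \<in> carrier K; y \<in> carrier K\<rbrakk>
    \<Longrightarrow> r \<odot>\<^bsub>plane\<^esub> vec x y = vec (r \<otimes> x) (r \<otimes> y)"
  by (simp add: plane_def)

lemma mult_vec [simp]:
  "\<lbrakk>x \<in> carrier K; y \<in> carrier K; x' \<in> carrier K; y' \<in> carrier K\<rbrakk>
    \<Longrightarrow> vec x y \<otimes>\<^bsub>plane\<^esub> vec x' y' =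
      vec (a \<otimes> (x \<otimes> x') \<oplus> c \<otimes> (y \<otimes> y')) (b \<otimes> (x \<otimes> x') \<oplus> d \<otimes> (y \<otimes> y'))"
  by (simp add: plane_def)

lemma abelian_group_plane: "abelian_group plane"
proof (rule abelian_groupI)
  fix v assume "v \<in> carrier plane"
  then obtain x y where v: "x \<in> carrier K" "y \<in> carrier K" "v = vec x y"
    by (rule plane_cases)
  then have "vec (\<ominus> x) (\<ominus> y) \<oplus>\<^bsub>plane\<^esub> v = \<zero>\<^bsub>plane\<^esub>"
    by (simp add: zero_plane l_neg)
  with v show "\<exists>w\<in>carrier plane. w \<oplus>\<^bsub>plane\<^esub> v = \<zero>\<^bsub>plane\<^esub>"
    by (intro bexI[of _ "vec (\<ominus> x) (\<ominus> y)"]) auto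
qed (auto elim!: plane_cases simp: zero_plane a_ac)

lemma module_plane: "Module.module K plane"
proof (rule Module.moduleI)
qed (use abelian_group_plane in
      \<open>auto elim!: plane_cases simp: l_distr r_distr m_assoc intro: is_cring\<close>)

lemma nonassoc_algebra_plane: "nonassoc_algebra K plane"
proof (intro nonassoc_algebra.intro vectorspace.intro nonassoc_algebra_axioms.intro)
qed (use module_plane field_axioms in
      \<open>auto elim!: plane_cases simp: l_distr r_distr m_ac a_ac\<close>)

end

sublocale evolution_plane \<subseteq> A: nonassoc_algebra K plane
  by (rule nonassoc_algebra_plane)

context evolution_plane
begin

lemma unit_vectors_in_plane: "unit_vectors \<subseteq> carrier plane"
  by (auto simp: unit_vectors_def)

lemma lincomb_unit_vectors:
  assumes "f \<in> unit_vectors \<rightarrow> carrier K"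
  shows "A.lincomb f unit_vectors = vec (f (vec \<one> \<zero>)) (f (vec \<zero> \<one>))"
proof -
  have "f (vec \<one> \<zero>) \<in> carrier K" "f (vec \<zero> \<one>) \<in> carrier K"
    using assms by (auto simp: unit_vectors_def)
  then show ?thesis
    by (simp add: A.lincomb_def unit_vectors_def Pi_def)
qed

lemma lincomb_support:
  assumes "f \<in> unit_vectors \<rightarrow> carrier K"
  shows "A.lincomb f {e \<in> unit_vectors. f e \<noteq> \<zero>} = A.lincomb f unit_vectors"
  unfolding A.lincomb_def
  using assms
  by (intro A.M.add.finprod_mono_neutral_cong_left)
     (auto simp: unit_vectors_def zero_plane)

lemma basis_unit_vectors: "A.basis unit_vectors"
  unfolding A.basis_def
proof (intro conjI)
  show "A.lin_indpt unit_vectors"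
  proof (rule A.finite_lin_indpt2)
    fix f assume f: "f \<in> unit_vectors \<rightarrow> carrier K"
      and "A.lincomb f unit_vectors = \<zero>\<^bsub>plane\<^esub>"
    then have "vec (f (vec \<one> \<zero>)) (f (vec \<zero> \<one>)) = vec \<zero> \<zero>"
      by (simp add: lincomb_unit_vectors zero_plane)
    with f show "\<forall>v\<in>unit_vectors. f v = \<zero>"
      by (auto simp: unit_vectors_def)
  qed (use unit_vectors_in_plane in \<open>auto simp: unit_vectors_def\<close>)
  show "A.span unit_vectors = carrier plane"
  proof
    show "A.span unit_vectors \<subseteq> carrier plane"
      by (rule A.span_is_subset2[OF unit_vectors_in_plane])
    show "carrier plane \<subseteq> A.span unit_vectors"
    proof
      fix v assume "v \<in> carrier plane"
      then obtain x y where v: "x \<in> carrier K" "y \<in> carrier K" "v = vec x y"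
        by (rule plane_cases)
      define f where "f = (\<lambda>e. if e = vec \<one> \<zero> then x else y)"
      have f: "f \<in> unit_vectors \<rightarrow> carrier K"
        using v by (auto simp: f_def)
      have "A.lincomb f unit_vectors = v"
        using v by (simp add: lincomb_unit_vectors[OF f]) (simp add: f_def)
      with f show "v \<in> A.span unit_vectors"
        unfolding A.span_def by (fastforce simp: unit_vectors_def)
    qed
  qed
qed (rule unit_vectors_in_plane)

lemma natural_basis_unit_vectors: "A.natural_basis unit_vectors"
  using basis_unit_vectors
  by (auto simp: A.natural_basis_def unit_vectors_def zero_plane)

lemma evolution_algebra_plane: "evolution_algebra K plane"
  by unfold_locales (use natural_basis_unit_vectors in blast)

text \<open>
  Coordinates are a definite description over combinations of the support of the coefficient
  family.  Padding the support to the whole basis (\<open>lincomb_support\<close>) reduces existence and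
  uniqueness to comparing the two entries of a vector.
\<close>

lemma coordinates_vec:
  assumes [simp]: "x \<in> carrier K" "y \<in> carrier K"
  shows "A.coordinates unit_vectors (vec x y) =
    (\<lambda>e\<in>unit_vectors. if e = vec \<one> \<zero> then x else y)" (is "_ = ?f")
  unfolding A.coordinates_def
proof (rule the_equality)
  have f: "?f \<in> unit_vectors \<rightarrow>\<^sub>E carrier K"
    by auto
  then have "?f \<in> unit_vectors \<rightarrow> carrier K"
    by (simp add: PiE_def)
  then have "A.lincomb ?f {e \<in> unit_vectors. ?f e \<noteq> \<zero>} = vec x y"
    unfolding lincomb_support[OF \<open>?f \<in> unit_vectors \<rightarrow> carrier K\<close>]
    by (simp add: lincomb_unit_vectors) (simp add: unit_vectors_def)
  with f show "?f \<in> unit_vectors \<rightarrow>\<^sub>E carrier K \<and>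
      finite {e \<in> unit_vectors. ?f e \<noteq> \<zero>} \<and>
      A.lincomb ?f {e \<in> unit_vectors. ?f e \<noteq> \<zero>} = vec x y"
    by (simp add: unit_vectors_def)
next
  fix g
  assume "g \<in> unit_vectors \<rightarrow>\<^sub>E carrier K \<and> finite {e \<in> unit_vectors. g e \<noteq> \<zero>} \<and>
      A.lincomb g {e \<in> unit_vectors. g e \<noteq> \<zero>} = vec x y"
  then have g: "g \<in> unit_vectors \<rightarrow>\<^sub>E carrier K"
    and "A.lincomb g {e \<in> unit_vectors. g e \<noteq> \<zero>} = vec x y"
    by auto
  moreover have g': "g \<in> unit_vectors \<rightarrow> carrier K"
    using g by (simp add: PiE_def)
  ultimately have "vec (g (vec \<one> \<zero>)) (g (vec \<zero> \<one>)) = vec x y"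
    by (simp add: lincomb_support lincomb_unit_vectors)
  with g' have "g (vec \<one> \<zero>) = x" "g (vec \<zero> \<one>) = y"
    by (auto simp: unit_vectors_def)
  with g show "g = ?f"
    by (intro extensionalityI[of g unit_vectors]) (auto simp: unit_vectors_def PiE_def)
qed

text \<open>
  The right-hand side mentions only the unit vectors and so is the same for all quadruples of
  nonzero constants: this is why the graph cannot see the determinant.
\<close>

lemma associated_graph_complete:
  assumes "a \<noteq> \<zero>" "b \<noteq> \<zero>" "c \<noteq> \<zero>" "d \<noteq> \<zero>"
  shows "A.associated_graph unit_vectors =
    \<lparr>verts = unit_vectors, arcs = unit_vectors \<times> unit_vectors, tail = fst, head = snd\<rparr>"
proof -
  have "A.structure_const unit_vectors f e \<noteq> \<zero>"
    if "e \<in> unit_vectors" "f \<in> unit_vectors" for e f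
    using that assms
    by (auto simp: A.structure_const_def unit_vectors_def
        coordinates_vec[unfolded unit_vectors_def])
  then show ?thesis
    by (auto simp: A.associated_graph_def)
qed

section \<open>Nonsingular structure constants\<close>

lemma perfect_if_det_nonzero:
  assumes det: "a \<otimes> d \<ominus> b \<otimes> c \<noteq> \<zero>"
  shows "A.perfect"
proof -
  let ?P = "A.set_product (carrier plane) (carrier plane)"
  define \<delta> where "\<delta> = inv (a \<otimes> d \<ominus> b \<otimes> c)"
  have \<delta> [simp]: "\<delta> \<in> carrier K" and \<delta>_det: "\<delta> \<otimes> (a \<otimes> d \<ominus> b \<otimes> c) = \<one>"
    using det by (auto simp: \<delta>_def field_Units)
  interpret P: LinearCombinations.submodule K ?P plane
    by (rule A.submodule_set_product) simp_all
  have u: "vec a b \<in> ?P"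
    using A.product_in_set_product[of "carrier plane" "carrier plane" "vec \<one> \<zero>" "vec \<one> \<zero>"] by simp
  have w: "vec c d \<in> ?P"
    using A.product_in_set_product[of "carrier plane" "carrier plane" "vec \<zero> \<one>" "vec \<zero> \<one>"] by simp
  have "vec x y \<in> ?P" if [simp]: "x \<in> carrier K" "y \<in> carrier K" for x y
  proof -
    \<comment> \<open>Cramer's rule for writing \<open>(x, y)\<close> as a combination of the squares \<open>(a, b)\<close> and \<open>(c, d)\<close>.\<close>
    let ?s = "\<delta> \<otimes> (d \<otimes> x \<ominus> c \<otimes> y)" and ?t = "\<delta> \<otimes> (a \<otimes> y \<ominus> b \<otimes> x)"
    have "?s \<otimes> a \<oplus> ?t \<otimes> c = (\<delta> \<otimes> (a \<otimes> d \<ominus> b \<otimes> c)) \<otimes> x"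
      using \<delta> const_closed that by algebra
    moreover have "?s \<otimes> b \<oplus> ?t \<otimes> d = (\<delta> \<otimes> (a \<otimes> d \<ominus> b \<otimes> c)) \<otimes> y"
      using \<delta> const_closed that by algebra
    ultimately have "?s \<odot>\<^bsub>plane\<^esub> vec a b \<oplus>\<^bsub>plane\<^esub> ?t \<odot>\<^bsub>plane\<^esub> vec c d = vec x y"
      by (simp add: \<delta>_det)
    moreover have "?s \<odot>\<^bsub>plane\<^esub> vec a b \<oplus>\<^bsub>plane\<^esub> ?t \<odot>\<^bsub>plane\<^esub> vec c d \<in> ?P"
      using u w by (intro P.m_closed P.smult_closed) auto
    ultimately show ?thesis by simp
  qed
  then have "carrier plane \<subseteq> ?P"
    by (auto elim!: plane_cases)
  with P.subset show ?thesis
    unfolding A.perfect_def by blast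
qed

lemma squares_independent:
  assumes det: "a \<otimes> d \<ominus> b \<otimes> c \<noteq> \<zero>"
    and [simp]: "s \<in> carrier K" "t \<in> carrier K"
    and eq: "a \<otimes> s \<oplus> c \<otimes> t = \<zero>" "b \<otimes> s \<oplus> d \<otimes> t = \<zero>"
  shows "s = \<zero>" "t = \<zero>"
proof -
  \<comment> \<open>Eliminate \<open>t\<close>, then \<open>s\<close>, from the two equations.\<close>
  have "(a \<otimes> d \<ominus> b \<otimes> c) \<otimes> s = d \<otimes> (a \<otimes> s \<oplus> c \<otimes> t) \<ominus> c \<otimes> (b \<otimes> s \<oplus> d \<otimes> t)"
    using assms(2,3) const_closed by algebra
  also have "\<dots> = \<zero>"
    by (simp add: eq a_minus_def)
  finally show "s = \<zero>"
    using det by (simp add: integral_iff)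
  have "(a \<otimes> d \<ominus> b \<otimes> c) \<otimes> t = a \<otimes> (b \<otimes> s \<oplus> d \<otimes> t) \<ominus> b \<otimes> (a \<otimes> s \<oplus> c \<otimes> t)"
    using assms(2,3) const_closed by algebra
  also have "\<dots> = \<zero>"
    by (simp add: eq a_minus_def)
  finally show "t = \<zero>"
    using det by (simp add: integral_iff)
qed

text \<open>
  The square of a vector is the combination of \<open>e\<^sub>1\<^sup>2\<close> and \<open>e\<^sub>2\<^sup>2\<close> whose coefficients are the
  squares of its entries, and a field has no nilpotent elements.
\<close>

lemma square_vec_eq_zero:
  assumes det: "a \<otimes> d \<ominus> b \<otimes> c \<noteq> \<zero>"
    and [simp]: "x \<in> carrier K" "y \<in> carrier K"
    and "vec x y \<otimes>\<^bsub>plane\<^esub> vec x y = \<zero>\<^bsub>plane\<^esub>"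
  shows "x = \<zero> \<and> y = \<zero>"
  using assms(4) squares_independent[OF det, of "x \<otimes> x" "y \<otimes> y"]
  by (simp add: zero_plane integral_iff)

text \<open>
  An ideal of square zero consists of vectors of square zero.
\<close>

lemma semiprime_if_det_nonzero:
  assumes det: "a \<otimes> d \<ominus> b \<otimes> c \<noteq> \<zero>"
  shows "A.semiprime"
  unfolding A.semiprime_def
proof (intro allI impI)
  fix I
  assume "A.two_sided_ideal I \<and> A.set_product I I = {\<zero>\<^bsub>plane\<^esub>}"
  then have sub: "LinearCombinations.submodule K I plane"
    and null: "A.set_product I I = {\<zero>\<^bsub>plane\<^esub>}"
    by (simp_all add: A.two_sided_ideal_def VectorSpace.subspace_def)
  interpret I: LinearCombinations.submodule K I plane by (rule sub)
  have "v = \<zero>\<^bsub>plane\<^esub>" if "v \<in> I" for v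
  proof -
    have "v \<in> carrier plane"
      using that I.subset by blast
    then obtain x y where v: "x \<in> carrier K" "y \<in> carrier K" "v = vec x y"
      by (rule plane_cases)
    have "v \<otimes>\<^bsub>plane\<^esub> v = \<zero>\<^bsub>plane\<^esub>"
      using A.product_in_set_product[OF I.subset I.subset that that] null by simp
    then have "x = \<zero> \<and> y = \<zero>"
      unfolding v(3) by (rule square_vec_eq_zero[OF det v(1,2)])
    then show ?thesis
      by (simp add: v(3) zero_plane)
  qed
  then show "I = {\<zero>\<^bsub>plane\<^esub>}"
    using I.zero_closed by blast
qed

section \<open>Squares on the diagonal\<close>

lemma diagonal_is_submodule: "LinearCombinations.submodule K {vec t t | t. t \<in> carrier K} plane"
  by (rule LinearCombinations.submodule.intro[OF module_plane]) (auto simp: zero_plane)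

lemma product_on_diagonal:
  assumes "b = a" "d = c" "v \<in> carrier plane" "w \<in> carrier plane"
  shows "v \<otimes>\<^bsub>plane\<^esub> w \<in> {vec t t | t. t \<in> carrier K}"
proof -
  obtain x y where v: "x \<in> carrier K" "y \<in> carrier K" "v = vec x y"
    using assms(3) by (rule plane_cases)
  obtain x' y' where w: "x' \<in> carrier K" "y' \<in> carrier K" "w = vec x' y'"
    using assms(4) by (rule plane_cases)
  define t where "t = a \<otimes> (x \<otimes> x') \<oplus> c \<otimes> (y \<otimes> y')"
  have "v \<otimes>\<^bsub>plane\<^esub> w = vec t (b \<otimes> (x \<otimes> x') \<oplus> d \<otimes> (y \<otimes> y'))"
    using v w by (simp add: t_def)
  also have "b \<otimes> (x \<otimes> x') \<oplus> d \<otimes> (y \<otimes> y') = t"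
    by (simp only: t_def assms(1,2))
  finally show ?thesis
    using v w by (auto simp: t_def)
qed

lemma not_perfect_if_squares_on_diagonal:
  assumes "b = a" "d = c"
  shows "\<not> A.perfect"
proof
  assume "A.perfect"
  moreover have "A.set_product (carrier plane) (carrier plane) \<subseteq> {vec t t | t. t \<in> carrier K}"
    unfolding A.set_product_def
    by (rule A.span_is_subset[OF _ diagonal_is_submodule])
       (use product_on_diagonal[OF assms] in blast)
  moreover have "vec \<one> \<zero> \<in> carrier plane"
    by simp
  ultimately have "vec \<one> \<zero> \<in> {vec t t | t. t \<in> carrier K}"
    unfolding A.perfect_def by blast
  then show False
    by auto
qed

text \<open>
  The witness is the diagonal.  It is an ideal because it contains all products, and
  \<open>(s, s) (t, t) = s t (e\<^sub>1\<^sup>2 + e\<^sub>2\<^sup>2)\<close> vanishes since the two squares cancel.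
\<close>

lemma not_semiprime_if_squares_opposite:
  assumes "b = a" "c = \<ominus> a" "d = \<ominus> a"
  shows "\<not> A.semiprime"
proof
  let ?I = "{vec t t | t. t \<in> carrier K}"
  have dc: "d = c"
    using assms by simp
  assume "A.semiprime"
  moreover have "A.two_sided_ideal ?I"
    unfolding A.two_sided_ideal_def VectorSpace.subspace_def
  proof (intro conjI ballI)
    fix v w assume "v \<in> carrier plane" and "w \<in> ?I"
    moreover from this have "w \<in> carrier plane"
      using LinearCombinations.submodule.subset[OF diagonal_is_submodule] by blast
    ultimately show "v \<otimes>\<^bsub>plane\<^esub> w \<in> ?I" "w \<otimes>\<^bsub>plane\<^esub> v \<in> ?I"
      by - (rule product_on_diagonal[OF assms(1) dc]; assumption)+
  qed (rule A.vectorspace_axioms, rule diagonal_is_submodule)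
  moreover have "A.set_product ?I ?I = {\<zero>\<^bsub>plane\<^esub>}"
  proof
    have "LinearCombinations.submodule K {\<zero>\<^bsub>plane\<^esub>} plane"
      by (rule LinearCombinations.submodule.intro[OF module_plane]) (auto simp: zero_plane)
    moreover have cancel: "a \<otimes> p \<oplus> c \<otimes> p = \<zero>" "b \<otimes> p \<oplus> d \<otimes> p = \<zero>" if "p \<in> carrier K" for p
      using that by (simp_all add: assms l_minus r_neg)
    ultimately show "A.set_product ?I ?I \<subseteq> {\<zero>\<^bsub>plane\<^esub>}"
      unfolding A.set_product_def
      by (intro A.span_is_subset) (auto simp: zero_plane cancel)
    have "LinearCombinations.submodule K (A.set_product ?I ?I) plane"
      by (rule A.submodule_set_product) auto
    then show "{\<zero>\<^bsub>plane\<^esub>} \<subseteq> A.set_product ?I ?I"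
      by (simp add: LinearCombinations.submodule.zero_closed)
  qed
  ultimately have "?I = {\<zero>\<^bsub>plane\<^esub>}"
    unfolding A.semiprime_def by blast
  moreover have "vec \<one> \<one> \<in> ?I"
    by blast
  ultimately have "vec \<one> \<one> = vec \<zero> \<zero>"
    by (simp only: zero_plane singleton_iff)
  then show False
    by simp
qed

end

section \<open>A small field in an infinite type\<close>

lemma finite_inj_into_infinite:
  assumes "finite S" and "infinite (UNIV :: 'b set)"
  obtains f :: "'a \<Rightarrow> 'b" where "inj_on f S"
proof -
  obtain T :: "'b set" where "finite T" "card T = card S"
    using infinite_arbitrarily_large[OF assms(2), of "card S"] by blast
  then show thesis
    using assms(1) that card_le_inj[of S T] by auto
qed

text \<open>
  The field is that of the integers modulo three, carried along an injection.  Finiteness is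
  recorded because it lets the plane over the field be embedded in the type of vectors.
\<close>

lemma ex_finite_field_char_neq_2:
  assumes "infinite (UNIV :: 'k set)"
  obtains K :: "'k ring" where "field K" "finite (carrier K)" "\<one>\<^bsub>K\<^esub> \<oplus>\<^bsub>K\<^esub> \<one>\<^bsub>K\<^esub> \<noteq> \<zero>\<^bsub>K\<^esub>"
proof -
  interpret F: residues_prime 3 "residue_ring 3"
    by unfold_locales simp_all
  obtain f :: "int \<Rightarrow> 'k" where f: "inj_on f (carrier (residue_ring 3))"
    using finite_inj_into_infinite[OF _ assms] F.finite by blast
  let ?K = "image_ring f (residue_ring 3)"
  have "f \<in> ring_hom (residue_ring 3) ?K"
    using inj_imp_image_ring_iso[OF f] by (simp add: ring_iso_def)
  then have "\<one>\<^bsub>?K\<^esub> \<oplus>\<^bsub>?K\<^esub> \<one>\<^bsub>?K\<^esub> = f (\<one>\<^bsub>residue_ring 3\<^esub> \<oplus>\<^bsub>residue_ring 3\<^esub> \<one>\<^bsub>residue_ring 3\<^esub>)"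
    by (simp add: ring_hom_add image_ring_one)
  also have "\<dots> = f 2"
    by (simp add: F.res_add_eq F.res_one_eq)
  also have "\<dots> \<noteq> \<zero>\<^bsub>?K\<^esub>"
    using inj_onD[OF f, of 2 0] by (auto simp: image_ring_zero F.res_zero_eq F.res_carrier_eq)
  finally show thesis
    using that[of ?K] F.inj_imp_image_ring_is_field[OF f] F.finite by (simp add: image_ring_carrier)
qed

section \<open>No graphical characterization\<close>

theorem proposition3p4:
  assumes "infinite (UNIV :: 'k set)" and "infinite (UNIV :: 'v set)"
  shows
    "(\<nexists>\<G> :: ('v, 'v \<times> 'v) pre_digraph set.
        iso_closed_graph_class \<G> \<and>
        (\<forall>(K :: 'k ring) (A :: ('k, 'v) module) (B :: 'v set).
           field K \<and> evolution_algebra K A \<and> nonassoc_algebra.natural_basis K A B \<longrightarrow>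
           (nonassoc_algebra.semiprime K A \<longleftrightarrow>
            nonassoc_algebra.associated_graph K A B \<in> \<G>)))
     \<and>
     (\<nexists>\<G> :: ('v, 'v \<times> 'v) pre_digraph set.
        iso_closed_graph_class \<G> \<and>
        (\<forall>(K :: 'k ring) (A :: ('k, 'v) module) (B :: 'v set).
           field K \<and> evolution_algebra K A \<and> nonassoc_algebra.natural_basis K A B \<longrightarrow>
           (nonassoc_algebra.perfect K A \<longleftrightarrow>
            nonassoc_algebra.associated_graph K A B \<in> \<G>)))"
proof -
  obtain K :: "'k ring" where K: "field K" "finite (carrier K)"
    and two: "\<one>\<^bsub>K\<^esub> \<oplus>\<^bsub>K\<^esub> \<one>\<^bsub>K\<^esub> \<noteq> \<zero>\<^bsub>K\<^esub>"
    using ex_finite_field_char_neq_2[OF assms(1)] .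
  interpret field K by (rule K)
  obtain g :: "'k \<times> 'k \<Rightarrow> 'v" where g: "inj_on g (carrier K \<times> carrier K)"
    using finite_inj_into_infinite[OF _ assms(2)] K(2) by (metis finite_cartesian_product)
  \<comment> \<open>\<open>P\<close> has determinant \<open>-2\<close>; in \<open>Q\<close> both squares are multiples of \<open>e\<^sub>1 + e\<^sub>2\<close>.\<close>
  let ?vec = "curry g" and ?n = "\<ominus>\<^bsub>K\<^esub> \<one>\<^bsub>K\<^esub>"
  interpret P: evolution_plane K ?vec "\<one>\<^bsub>K\<^esub>" "\<one>\<^bsub>K\<^esub>" "\<one>\<^bsub>K\<^esub>" ?n
    by unfold_locales (use g in auto)
  interpret Q: evolution_plane K ?vec "\<one>\<^bsub>K\<^esub>" "\<one>\<^bsub>K\<^esub>" ?n ?n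
    by unfold_locales (use g in auto)
  let ?B = "P.unit_vectors"
  have n: "?n \<noteq> \<zero>\<^bsub>K\<^esub>"
    by (simp add: local.minus_eq)
  have "\<one>\<^bsub>K\<^esub> \<otimes>\<^bsub>K\<^esub> ?n \<ominus>\<^bsub>K\<^esub> \<one>\<^bsub>K\<^esub> \<otimes>\<^bsub>K\<^esub> \<one>\<^bsub>K\<^esub> = \<ominus>\<^bsub>K\<^esub> (\<one>\<^bsub>K\<^esub> \<oplus>\<^bsub>K\<^esub> \<one>\<^bsub>K\<^esub>)"
    by algebra
  then have det: "\<one>\<^bsub>K\<^esub> \<otimes>\<^bsub>K\<^esub> ?n \<ominus>\<^bsub>K\<^esub> \<one>\<^bsub>K\<^esub> \<otimes>\<^bsub>K\<^esub> \<one>\<^bsub>K\<^esub> \<noteq> \<zero>\<^bsub>K\<^esub>"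
    using two by simp
  have graph: "P.A.associated_graph ?B = Q.A.associated_graph ?B"
    using P.associated_graph_complete Q.associated_graph_complete n
    by simp
  have "Q.A.natural_basis ?B"
    using Q.natural_basis_unit_vectors by simp
  then show ?thesis
    using graph P.semiprime_if_det_nonzero[OF det] P.perfect_if_det_nonzero[OF det]
      Q.not_semiprime_if_squares_opposite Q.not_perfect_if_squares_on_diagonal
      P.natural_basis_unit_vectors P.evolution_algebra_plane Q.evolution_algebra_plane K(1)
    by metis
qed

end
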